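(* There exists a sequence of graphs $G_n$, with $G_n$ having $n$ vertices (for $n$ ranging over an infinite set of positive integers), such that the transition graph $\mathcal{G}(G_n)$ is connected but has diameter $\Omega(n^2)$; that is, there is a constant $c>0$ such that the diameter of $\mathcal{G}(G_n)$ is at least $c\,n^2$ for all sufficiently large $n$ in this set.
   Context: Graphs are finite, simple and undirected. The transition graph $\mathcal{G}(G)$ of the switch chain on a graph $G=(V,E)$ has one vertex for each perfect matching of $G$; two perfect matchings $M,M'$ are adjacent iff they differ by a single switch, i.e. there are edges $uv,u'v'\in M$ such that $u'v,uv'\in E$ and $M'=(M\setminus\{uv,u'v'\})\cup\{u'v,uv'\}$. *)

theory Defs
  imports "Graph_Theory.Graph_Theory"
begin

text \<open>
  A finite simple undirected graph is a \<^term>\<open>pair_graph\<close>: the finite, loop-free, symmetric digraph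
  that has both arcs (u, v) and (v, u) for every edge uv.  Matchings consist of undirected edges,
  so the two arcs of an edge are identified with the set {u, v}.
\<close>

definition edge_set :: "'a pair_pre_digraph \<Rightarrow> 'a set set" where
  "edge_set G = {{u, v} |u v. (u, v) \<in> parcs G}"

definition perfect_matching :: "'a pair_pre_digraph \<Rightarrow> 'a set set \<Rightarrow> bool" where
  "perfect_matching G M \<longleftrightarrow>
     M \<subseteq> edge_set G \<and> (\<forall>w \<in> pverts G. \<exists>!e. e \<in> M \<and> w \<in> e)"

definition switch :: "'a pair_pre_digraph \<Rightarrow> 'a set set \<Rightarrow> 'a set set \<Rightarrow> bool" where
  "switch G M M' \<longleftrightarrow>
     (\<exists>u v u' v'. {u, v} \<in> M \<and> {u', v'} \<in> M \<and>
        {u', v} \<in> edge_set G \<and> {u, v'} \<in> edge_set G \<and>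
        M' = (M - {{u, v}, {u', v'}}) \<union> {{u', v}, {u, v'}})"

text \<open>
  The condition that M and M' are distinct excludes the degenerate switch with u = u' and v = v',
  which would put a loop at every vertex.
\<close>

definition transition_graph :: "'a pair_pre_digraph \<Rightarrow> 'a set set pair_pre_digraph" where
  "transition_graph G =
     \<lparr>pverts = {M. perfect_matching G M},
      parcs = {(M, M'). perfect_matching G M \<and> perfect_matching G M' \<and> M \<noteq> M' \<and> switch G M M'}\<rparr>"

text \<open>
  With unit arc weights, \<^term>\<open>wf_digraph.\<mu>\<close> is the number of arcs on a shortest walk,
  with value \<open>\<infinity>\<close> if there is no walk.
\<close>

definition graph_diameter :: "'a pair_pre_digraph \<Rightarrow> ereal" where
  "graph_diameter G =
     (SUP u \<in> pverts G. SUP v \<in> pverts G. wf_digraph.\<mu> (with_proj G) (\<lambda>_. 1) u v)"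

lemma switch_sym:
  assumes G: "pair_graph G" and M: "perfect_matching G M" and ne: "M \<noteq> M'" and sw: "switch G M M'"
  shows "switch G M' M"
proof -
  interpret pair_graph G by (rule G)
  from sw obtain u v u' v' where
    e: "{u, v} \<in> M" "{u', v'} \<in> M" and
    f: "{u', v} \<in> edge_set G" "{u, v'} \<in> edge_set G" and
    M': "M' = (M - {{u, v}, {u', v'}}) \<union> {{u', v}, {u, v'}}"
    unfolding switch_def by blast
  have sub: "M \<subseteq> edge_set G" using M by (simp add: perfect_matching_def)
  have in_verts: "w \<in> pverts G" if "h \<in> edge_set G" "w \<in> h" for h w
    using that by (auto simp: edge_set_def dest: in_arcsD1 in_arcsD2)
  have uniq: "h = k" if "h \<in> M" "k \<in> M" "w \<in> h" "w \<in> k" for h k w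
  proof -
    have "w \<in> pverts G" using in_verts that sub by blast
    then have "\<exists>!e. e \<in> M \<and> w \<in> e" using M by (simp add: perfect_matching_def)
    then show ?thesis using that by blast
  qed
  have deg: "\<not> (u = u' \<and> v = v')"
    using M' ne e by auto
  have "{u', v} \<notin> M"
  proof
    assume a: "{u', v} \<in> M"
    have "{u, v} = {u', v}" using uniq[OF e(1) a, of v] by simp
    moreover have "{u', v'} = {u', v}" using uniq[OF e(2) a, of u'] by simp
    ultimately show False using deg by (auto simp: doubleton_eq_iff)
  qed
  moreover have "{u, v'} \<notin> M"
  proof
    assume a: "{u, v'} \<in> M"
    have "{u, v} = {u, v'}" using uniq[OF e(1) a, of u] by simp
    moreover have "{u', v'} = {u, v'}" using uniq[OF e(2) a, of v'] by simp
    ultimately show False using deg by (auto simp: doubleton_eq_iff)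
  qed
  ultimately have "M = (M' - {{u', v}, {u, v'}}) \<union> {{u, v}, {u', v'}}"
    using e M' by blast
  moreover have "{u', v} \<in> M'" "{u, v'} \<in> M'" using M' by auto
  moreover have "{u, v} \<in> edge_set G" "{u', v'} \<in> edge_set G" using e sub by auto
  ultimately show ?thesis unfolding switch_def by blast
qed

lemma pair_graph_transition_graph:
  assumes "pair_graph G"
  shows "pair_graph (transition_graph G)"
proof -
  interpret pair_graph G by (rule assms)
  have "edge_set G \<subseteq> Pow (pverts G)"
    by (auto simp: edge_set_def dest: in_arcsD1 in_arcsD2)
  then have "finite (edge_set G)"
    using finite_verts by (meson finite_Pow_iff finite_subset)
  then have fin: "finite {M. perfect_matching G M}"
    by (rule finite_subset[rotated, OF finite_Pow_iff[THEN iffD2]]) (auto simp: perfect_matching_def)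
  have "finite (parcs (transition_graph G))"
    by (rule finite_subset[OF _ finite_cartesian_product[OF fin fin]])
      (auto simp: transition_graph_def)
  moreover have "sym (parcs (transition_graph G))"
    using switch_sym[OF assms] by (auto simp: transition_graph_def intro!: symI)
  ultimately show ?thesis
    using fin by unfold_locales (auto simp: transition_graph_def symmetric_def)
qed

lemma wf_transition_graph:
  assumes "pair_graph G"
  shows "wf_digraph (with_proj (transition_graph G))"
proof -
  interpret pair_graph "transition_graph G" by (rule pair_graph_transition_graph[OF assms])
  show ?thesis by unfold_locales
qed

end

theory Submission
  imports Defs
begin

text \<open>
  Winding a path around itself gives a planar graph whose bounded faces are all quadrilaterals: the
  vertices are 0, ..., n - 1, with edges v ~ v + 1 along the spiral and v ~ v + 5 between consecutive
  turns, and the chord {0, 3} splits the innermost hexagon.  A switch flips a quadrilateral, which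
  changes the height function of the matching on few faces only.  For two suitable
  matchings the heights differ on average by a multiple of n, hence by a multiple of \<open>n\<^sup>2\<close> in
  total, which gives the lower bound on the diameter.  The total height is
  a weighted count of the spiral edges in the matching, and in this form (\<open>potential\<close>) the
  lower bound needs no topology.  For connectivity, a matching with nonzero heights admits a switch
  next to the outermost face of maximal height that lowers the potential, so every matching
  descends to the unique one with height zero.
\<close>

section \<open>Exchanging two edges of a perfect matching\<close>

lemma perfect_matching_unique:
  assumes "pair_graph G" "perfect_matching G M" "e \<in> M" "f \<in> M" "w \<in> e" "w \<in> f"
  shows "e = f"
proof -
  interpret pair_graph G by (rule assms(1))
  have "e \<in> edge_set G" using assms by (auto simp: perfect_matching_def)
  then have "w \<in> pverts G"
    using \<open>w \<in> e\<close> by (auto simp: edge_set_def dest: in_arcsD1 in_arcsD2)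
  then show ?thesis using assms by (auto simp: perfect_matching_def)
qed

lemma edge_set_neq:
  assumes "pair_graph G" "{a, b} \<in> edge_set G"
  shows "a \<noteq> b"
proof -
  interpret pair_graph G by (rule assms(1))
  show ?thesis using assms(2) no_loops by (fastforce simp: edge_set_def doubleton_eq_iff)
qed

lemma matched_pair_unique:
  assumes "pair_graph G" "perfect_matching G M" "{x, y} \<in> M" "{x, z} \<in> M"
  shows "y = z"
proof -
  have "{x, y} = {x, z}"
    using perfect_matching_unique[OF assms, of x] by simp
  then show ?thesis by (auto simp: doubleton_eq_iff)
qed

text \<open>Different edges of \<open>M\<close> share no vertex, and the new edges are not loops. A
  new edge already in \<open>M\<close> would meet an old one and coincide with it, against this
  distinctness.\<close>

lemma exchange_distinct:
  assumes G: "pair_graph G" and M: "perfect_matching G M"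
    and in_M: "{a, b} \<in> M" "{c, d} \<in> M" and ne: "{a, b} \<noteq> {c, d}"
    and edges: "{c, b} \<in> edge_set G" "{a, d} \<in> edge_set G"
  shows "distinct [a, b, c, d]" "{c, b} \<notin> M" "{a, d} \<notin> M"
proof -
  note uniq = matched_pair_unique[OF G M]
  have "M \<subseteq> edge_set G" using M by (simp add: perfect_matching_def)
  then have "a \<noteq> b" "c \<noteq> d" "c \<noteq> b" "a \<noteq> d"
    using edge_set_neq[OF G] in_M edges by blast+
  moreover have "a \<noteq> c" "b \<noteq> d"
    using uniq[of a b d] uniq[of b a c] in_M ne by (auto simp: insert_commute)
  ultimately show "distinct [a, b, c, d]" "{c, b} \<notin> M" "{a, d} \<notin> M"
    using uniq[of b a c] uniq[of a b d] in_M by (auto simp: insert_commute)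
qed

text \<open>The removed and the inserted pair of edges each cover \<open>a\<close>,
  \<open>b\<close>, \<open>c\<close>, \<open>d\<close> exactly once, and every other vertex keeps
  its edge.\<close>

lemma perfect_matching_exchange:
  assumes G: "pair_graph G" and M: "perfect_matching G M"
    and in_M: "{a, b} \<in> M" "{c, d} \<in> M" and ne: "{a, b} \<noteq> {c, d}"
    and edges: "{c, b} \<in> edge_set G" "{a, d} \<in> edge_set G"
  defines "M' \<equiv> M - {{a, b}, {c, d}} \<union> {{c, b}, {a, d}}"
  shows "perfect_matching G M'" "switch G M M'"
proof -
  have sub: "M \<subseteq> edge_set G" using M by (simp add: perfect_matching_def)
  note dist = exchange_distinct(1)[OF G M in_M ne edges]
  have uniq_edge: "e = f" if "e \<in> M" "f \<in> M" "w \<in> e" "w \<in> f" for e f w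
    using perfect_matching_unique[OF G M that] .
  show "switch G M M'"
    unfolding switch_def M'_def using in_M edges by blast
  show "perfect_matching G M'"
    unfolding perfect_matching_def
  proof (intro conjI ballI)
    show "M' \<subseteq> edge_set G" using sub edges by (auto simp: M'_def)
    fix w assume "w \<in> pverts G"
    then obtain e where e: "e \<in> M" "w \<in> e" using M by (auto simp: perfect_matching_def)
    consider "w \<in> {c, b}" | "w \<in> {a, d}" | "w \<notin> {a, b, c, d}" by auto
    then show "\<exists>!e. e \<in> M' \<and> w \<in> e"
    proof cases
      case 1
      then have "f = {c, b}" if "f \<in> M'" "w \<in> f" for f
        using that dist uniq_edge[of f "{a, b}" w] uniq_edge[of f "{c, d}" w] in_M
        by (auto simp: M'_def)
      then show ?thesis using 1 by (intro ex1I[of _ "{c, b}"]) (auto simp: M'_def)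
    next
      case 2
      then have "f = {a, d}" if "f \<in> M'" "w \<in> f" for f
        using that dist uniq_edge[of f "{a, b}" w] uniq_edge[of f "{c, d}" w] in_M
        by (auto simp: M'_def)
      then show ?thesis using 2 by (intro ex1I[of _ "{a, d}"]) (auto simp: M'_def)
    next
      case 3
      then have "f = e" if "f \<in> M'" "w \<in> f" for f
        using that uniq_edge[of f e w] e by (auto simp: M'_def)
      then show ?thesis using 3 e by (intro ex1I[of _ e]) (auto simp: M'_def)
    qed
  qed
qed

section \<open>Diameter and connectivity from a function on the vertices\<close>

lemma awalk_lipschitz:
  fixes f :: "'a \<Rightarrow> real"
  assumes "pair_graph H" and lip: "\<And>x y. (x, y) \<in> parcs H \<Longrightarrow> \<bar>f y - f x\<bar> \<le> L"
    and "pre_digraph.awalk (with_proj H) u p v"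
  shows "\<bar>f v - f u\<bar> \<le> L * length p"
proof -
  interpret pair_graph H by (rule assms(1))
  show ?thesis using assms(3)
  proof (induction p arbitrary: u)
    case Nil
    then show ?case by (simp add: awalk_Nil_iff)
  next
    case (Cons e p)
    then have "(u, snd e) \<in> parcs H" "awalk (snd e) p v"
      by (auto simp: awalk_Cons_iff)
    then have "\<bar>f (snd e) - f u\<bar> \<le> L" "\<bar>f v - f (snd e)\<bar> \<le> L * length p"
      using lip Cons.IH by auto
    then show ?case by (simp add: algebra_simps)
  qed
qed

text \<open>Each arc changes \<open>f\<close> by at most \<open>L\<close>, so every walk from
  \<open>u\<close> to \<open>v\<close> has at least \<open>b\<close> arcs. If there is no walk, the
  infimum is infinite and the bound still holds.\<close>

lemma graph_diameter_ge:
  fixes f :: "'a \<Rightarrow> real"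
  assumes H: "pair_graph H" and lip: "\<And>x y. (x, y) \<in> parcs H \<Longrightarrow> \<bar>f y - f x\<bar> \<le> L"
    and "L > 0" "u \<in> pverts H" "v \<in> pverts H" "L * b \<le> f v - f u"
  shows "ereal b \<le> graph_diameter H"
proof -
  interpret pair_graph H by (rule H)
  have "b \<le> awalk_cost (\<lambda>_. 1) p" if "awalk u p v" for p
  proof -
    have "L * b \<le> L * length p"
      using awalk_lipschitz[of H f L, OF H lip that] assms(6) by simp
    then have "b \<le> length p" using \<open>L > 0\<close> by simp
    also have "real (length p) = awalk_cost (\<lambda>_. 1) p"
      by (simp add: awalk_cost_def sum_list_triv)
    finally show ?thesis .
  qed
  then have "ereal b \<le> \<mu> (\<lambda>_. 1) u v"
    unfolding \<mu>_def by (auto intro: INF_greatest)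
  also have "\<dots> \<le> graph_diameter H"
    unfolding graph_diameter_def
    by (rule SUP_upper2[OF assms(4)], rule SUP_upper[OF assms(5)])
  finally show ?thesis .
qed

text \<open>In a finite graph a strict descent must stop, and it can stop only at \<open>r\<close>.
  Symmetry of the arcs then joins any two vertices through \<open>r\<close>.\<close>

lemma connected_if_descent:
  fixes f :: "'a \<Rightarrow> int"
  assumes "pair_graph H" "r \<in> pverts H"
    and descent: "\<And>x. x \<in> pverts H \<Longrightarrow> x \<noteq> r \<Longrightarrow> \<exists>y. (x, y) \<in> parcs H \<and> f y < f x"
  shows "Digraph_Component.connected (with_proj H)"
proof -
  interpret pair_graph H by (rule assms(1))
  have reach: "x \<rightarrow>\<^sup>*\<^bsub>with_proj H\<^esub> r" if "x \<in> pverts H" for x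
    using that
  \<comment> \<open>Values of \<open>f\<close> may be negative, so the induction counts the vertices
    of smaller value.\<close>
  proof (induction "card {y \<in> pverts H. f y < f x}" arbitrary: x rule: less_induct)
    case less
    show ?case
    proof (cases "x = r")
      case True
      then show ?thesis using less.prems by simp
    next
      case False
      then obtain y where y: "(x, y) \<in> parcs H" "f y < f x"
        using descent less.prems by blast
      then have "y \<in> pverts H" by (blast dest: in_arcsD2)
      have "{z \<in> pverts H. f z < f y} \<subset> {z \<in> pverts H. f z < f x}"
        using y \<open>y \<in> pverts H\<close> by auto
      then have "y \<rightarrow>\<^sup>*\<^bsub>with_proj H\<^esub> r"
        using \<open>y \<in> pverts H\<close> finite_verts by (intro less.hyps psubset_card_mono) auto
      then show ?thesis using y(1) by (auto intro: adj_reachable_trans)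
    qed
  qed
  have "x \<rightarrow>\<^sup>*\<^bsub>with_proj H\<^esub> y" if "x \<in> pverts H" "y \<in> pverts H" for x y
    using reach[OF that(1)] reach[OF that(2)] symmetric_reachable[OF sym_arcs]
    by (auto intro: reachable_trans)
  then have "strongly_connected (with_proj H)"
    using assms(2) by (intro strongly_connectedI) auto
  then show ?thesis
    unfolding connected_def strongly_connected_def
    by (auto simp: reachable_mk_symmetric_eq[OF sym_arcs])
qed

section \<open>Adjacency in the spiral and weights around a quadrilateral\<close>

text \<open>Adjacent vertices have opposite parity, since 1, 3 and 5 are odd. No bound
  \<open>n\<close> occurs here, so facts about quadrilaterals are independent of the size.\<close>

definition spiral_adj :: "nat \<Rightarrow> nat \<Rightarrow> bool" where
  "spiral_adj x y \<longleftrightarrow> y = x + 1 \<or> x = y + 1 \<or> y = x + 5 \<or> x = y + 5 \<or> {x, y} = {0, 3}"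

lemma spiral_adj_sym: "spiral_adj x y \<longleftrightarrow> spiral_adj y x"
  by (auto simp: spiral_adj_def doubleton_eq_iff)

lemma spiral_adj_neq: "spiral_adj x y \<Longrightarrow> x \<noteq> y"
  by (auto simp: spiral_adj_def doubleton_eq_iff)

text \<open>
  Up to a constant, \<open>wt v\<close> is the coefficient of the edge {v, v + 1} in the sum of all heights: the edge
  enters the heights, defined below, of v, v - 5, ..., v mod 5, with sign depending on the parity of v.
\<close>

definition wt :: "nat \<Rightarrow> int" where
  "wt v = (if even v then - int (v div 5 + 1) else int (v div 5 + 1))"

definition edge_wt :: "nat \<Rightarrow> nat \<Rightarrow> int" where
  "edge_wt x y = (if y = x + 1 then wt x else if x = y + 1 then wt y else 0)"

lemma edge_wt_sym: "edge_wt x y = edge_wt y x"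
  by (auto simp: edge_wt_def)

text \<open>By symmetry u may be taken to be the least vertex of the quadrilateral, leaving three shapes.\<close>

lemma edge_wt_quad_min:
  assumes adj: "spiral_adj u v" "spiral_adj u' v'" "spiral_adj u' v" "spiral_adj u v'"
    and less: "u < u'" "u < v" "v < v'"
  shows "\<bar>edge_wt u' v + edge_wt u v' - edge_wt u v - edge_wt u' v'\<bar> \<le> 3"
proof -
  have "v = u + 1 \<and> v' = u + 5 \<or> u = 0 \<and> v = 1 \<and> v' = 3 \<or> u = 0 \<and> v = 3 \<and> v' = 5"
    using adj(1,4) less unfolding spiral_adj_def doubleton_eq_iff by auto
  then show ?thesis
  proof (elim disjE conjE)
    assume v: "v = u + 1" "v' = u + 5"
    have "u' = u + 6"
      using adj(2,3) less unfolding v spiral_adj_def doubleton_eq_iff by auto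
    then show ?thesis by (simp add: v edge_wt_def wt_def)
  next
    \<comment> \<open>This face has three spiral edges and attains the bound 3. The expression has
      absolute value 2 for the face 0, 3, 4, 5 and 1 for the first shape.\<close>
    assume v: "u = 0" "v = 1" "v' = 3"
    have "u' = 2"
      using adj(2,3) less unfolding v spiral_adj_def doubleton_eq_iff by auto
    then show ?thesis by (simp add: v edge_wt_def wt_def)
  next
    assume v: "u = 0" "v = 3" "v' = 5"
    have "u' = 4"
      using adj(2,3) less unfolding v spiral_adj_def doubleton_eq_iff by auto
    then show ?thesis by (simp add: v edge_wt_def wt_def)
  qed
qed

text \<open>Relabelling the quadrilateral so that its least vertex comes first changes the
  expression at most in sign.\<close>

lemma edge_wt_quad:
  assumes "spiral_adj u v" "spiral_adj u' v'" "spiral_adj u' v" "spiral_adj u v'" "u \<noteq> u'" "v \<noteq> v'"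
  shows "\<bar>edge_wt u' v + edge_wt u v' - edge_wt u v - edge_wt u' v'\<bar> \<le> 3"
proof -
  have min: "\<bar>edge_wt u' v + edge_wt u v' - edge_wt u v - edge_wt u' v'\<bar> \<le> 3"
    if "spiral_adj u v" "spiral_adj u' v'" "spiral_adj u' v" "spiral_adj u v'"
      "u < u'" "u < v" "u < v'" "v \<noteq> v'" for u v u' v'
  proof (cases "v < v'")
    case True
    then show ?thesis using edge_wt_quad_min[of u v u' v'] that by simp
  next
    case False
    then show ?thesis using edge_wt_quad_min[of u v' u' v] that by simp
  qed
  have sym: "spiral_adj v u" "spiral_adj v' u'" "spiral_adj v u'" "spiral_adj v' u"
    using assms by (simp_all add: spiral_adj_sym)
  have ne: "u \<noteq> v" "u' \<noteq> v'" "u' \<noteq> v" "u \<noteq> v'"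
    using assms by (auto dest: spiral_adj_neq)
  note w = edge_wt_sym[of v u] edge_wt_sym[of v' u'] edge_wt_sym[of v u'] edge_wt_sym[of v' u]
  consider "u < u'" "u < v" "u < v'" | "u' < u" "u' < v" "u' < v'"
    | "v < u" "v < u'" "v < v'" | "v' < u" "v' < u'" "v' < v"
    using ne assms(5,6) by linarith
  then show ?thesis
  proof cases
    case 1 then show ?thesis using min[of u v u' v'] assms by simp
  next
    case 2 then show ?thesis using min[of u' v' u v] assms by simp
  next
    case 3 then show ?thesis using min[of v u v' u'] assms sym w by simp
  next
    case 4 then show ?thesis using min[of v' u' v u] assms sym w by simp
  qed
qed


section \<open>The spiral graph and the potential of a matching\<close>

definition spiral :: "nat \<Rightarrow> nat pair_pre_digraph" where
  "spiral n = \<lparr>pverts = {..<n}, parcs = {(x, y). x < n \<and> y < n \<and> spiral_adj x y}\<rparr>"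

lemma pverts_spiral [simp]: "pverts (spiral n) = {..<n}"
  by (simp add: spiral_def)

lemma pair_graph_spiral: "pair_graph (spiral n)"
proof -
  have "finite (parcs (spiral n))"
    by (rule finite_subset[of _ "{..<n} \<times> {..<n}"]) (auto simp: spiral_def)
  moreover have "sym (parcs (spiral n))"
    by (auto simp: spiral_def spiral_adj_sym intro!: symI)
  ultimately show ?thesis
    by unfold_locales (auto simp: spiral_def symmetric_def dest: spiral_adj_neq)
qed

lemma edge_set_spiral: "{x, y} \<in> edge_set (spiral n) \<longleftrightarrow> x < n \<and> y < n \<and> spiral_adj x y"
  by (auto simp: edge_set_def spiral_def doubleton_eq_iff spiral_adj_sym)

definition potential :: "nat \<Rightarrow> nat set set \<Rightarrow> int" where
  "potential n M = (\<Sum>v<n. of_bool ({v, v + 1} \<in> M) * wt v)"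

lemma sum_edge_wt:
  assumes "x < n" "y < n" "x \<noteq> y"
  shows "(\<Sum>v<n. of_bool ({v, v + 1} = {x, y}) * wt v) = edge_wt x y"
proof -
  consider "y = x + 1" | "x = y + 1" | "y \<noteq> x + 1" "x \<noteq> y + 1" by blast
  then show ?thesis
  proof cases
    case 1
    then have "of_bool ({v, v + 1} = {x, y}) * wt v = (if v = x then wt v else 0)" for v
      by (auto simp: doubleton_eq_iff)
    then show ?thesis using 1 assms by (simp add: edge_wt_def del: mult_eq_0_iff)
  next
    case 2
    then have "of_bool ({v, v + 1} = {x, y}) * wt v = (if v = y then wt v else 0)" for v
      by (auto simp: doubleton_eq_iff)
    then show ?thesis using 2 assms by (simp add: edge_wt_def del: mult_eq_0_iff)
  next
    case 3
    then have "{v, v + 1} \<noteq> {x, y}" for v by (auto simp: doubleton_eq_iff)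
    then show ?thesis using 3 by (simp add: edge_wt_def)
  qed
qed

text \<open>Written with indicators, an exchange is a sum, so the change of a weighted edge count
  splits into the contributions of the four edges.\<close>

lemma of_bool_exchange:
  assumes "A \<in> M" "B \<in> M" "A \<noteq> B" "C \<notin> M" "D \<notin> M" "C \<noteq> D"
  shows "of_bool (e \<in> M - {A, B} \<union> {C, D})
    = of_bool (e \<in> M) + of_bool (e = C) + of_bool (e = D) - of_bool (e = A) - (of_bool (e = B) :: int)"
  using assms by (cases "e = A"; cases "e = B"; cases "e = C"; cases "e = D") auto

lemma potential_exchange:
  assumes M: "perfect_matching (spiral n) M"
    and in_M: "{a, b} \<in> M" "{c, d} \<in> M" and ne: "{a, b} \<noteq> {c, d}"
    and edges: "{c, b} \<in> edge_set (spiral n)" "{a, d} \<in> edge_set (spiral n)"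
  shows "potential n (M - {{a, b}, {c, d}} \<union> {{c, b}, {a, d}})
    = potential n M + (edge_wt c b + edge_wt a d - edge_wt a b - edge_wt c d)"
proof -
  note ex = exchange_distinct[OF pair_graph_spiral M in_M ne edges]
  have lt: "a < n" "b < n" "c < n" "d < n" using edges by (auto simp: edge_set_spiral)
  have "{c, b} \<noteq> {a, d}" using ex(1) by (auto simp: doubleton_eq_iff)
  then have ind: "of_bool (e \<in> M - {{a, b}, {c, d}} \<union> {{c, b}, {a, d}})
    = of_bool (e \<in> M) + of_bool (e = {c, b}) + of_bool (e = {a, d})
      - of_bool (e = {a, b}) - (of_bool (e = {c, d}) :: int)" for e
    using of_bool_exchange[OF in_M ne ex(2,3)] by blast
  have "c \<noteq> b" "a \<noteq> d" "a \<noteq> b" "c \<noteq> d" using ex(1) by auto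
  note wts = sum_edge_wt[OF lt(3,2) this(1)] sum_edge_wt[OF lt(1,4) this(2)]
    sum_edge_wt[OF lt(1,2) this(3)] sum_edge_wt[OF lt(3,4) this(4)]
  show ?thesis
    unfolding potential_def ind distrib_right left_diff_distrib sum.distrib sum_subtractf wts by simp
qed

lemma potential_switch:
  assumes M: "perfect_matching (spiral n) M" and "M \<noteq> M'" and "switch (spiral n) M M'"
  shows "\<bar>potential n M' - potential n M\<bar> \<le> 3"
proof -
  obtain u v u' v' where in_M: "{u, v} \<in> M" "{u', v'} \<in> M"
    and edges: "{u', v} \<in> edge_set (spiral n)" "{u, v'} \<in> edge_set (spiral n)"
    and M': "M' = M - {{u, v}, {u', v'}} \<union> {{u', v}, {u, v'}}"
    using assms(3) unfolding switch_def by blast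
  have adj: "spiral_adj u v" "spiral_adj u' v'" "spiral_adj u' v" "spiral_adj u v'"
    using M in_M edges by (auto simp: perfect_matching_def edge_set_spiral subset_iff)
  have ne: "{u, v} \<noteq> {u', v'}"
  proof
    assume "{u, v} = {u', v'}"
    \<comment> \<open>The other identification, \<open>u = v'\<close> and \<open>v = u'\<close>,
      would make the new edge \<open>{u', v}\<close> a loop.\<close>
    then have "u = u' \<and> v = v'" using adj(3) spiral_adj_neq by (auto simp: doubleton_eq_iff)
    then show False using M' in_M \<open>M \<noteq> M'\<close> by auto
  qed
  have "distinct [u, v, u', v']"
    using exchange_distinct(1)[OF pair_graph_spiral M in_M ne edges] .
  then have "\<bar>edge_wt u' v + edge_wt u v' - edge_wt u v - edge_wt u' v'\<bar> \<le> 3"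
    using adj by (intro edge_wt_quad) auto
  then show ?thesis
    unfolding M' potential_exchange[OF M in_M ne edges] by simp
qed

section \<open>Heights of a perfect matching\<close>

text \<open>The reference matching, of height zero everywhere; it is the root to which all others
  descend.\<close>

definition base_matching :: "nat \<Rightarrow> nat set set" where
  "base_matching n = {{v, v + 1} |v. even v \<and> v < n}"

locale spiral_matching =
  fixes n :: nat and M :: "nat set set"
  assumes even_n: "even n" and matching: "perfect_matching (spiral n) M"
begin

text \<open>Integer indicators turn the condition that a vertex is matched exactly once into a
  linear equation.\<close>

definition step_in :: "nat \<Rightarrow> int" where
  "step_in v = of_bool ({v, v + 1} \<in> M)"

definition jump_in :: "nat \<Rightarrow> int" where
  "jump_in v = of_bool ({v, v + 5} \<in> M)"

definition chord_in :: int where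
  "chord_in = of_bool ({0, 3} \<in> M)"

lemma in_matchingD:
  assumes "{x, y} \<in> M"
  shows "x < n" "y < n" "spiral_adj x y"
proof -
  have "{x, y} \<in> edge_set (spiral n)" using assms matching by (auto simp: perfect_matching_def)
  then show "x < n" "y < n" "spiral_adj x y" by (simp_all add: edge_set_spiral)
qed

text \<open>The partner \<open>x\<close> of \<open>w\<close> determines the indicators of all edges
  at \<open>w\<close>, so each vertex equation reduces to running through the possible neighbours.
  Inner neighbours are written as \<open>w = u + 1\<close> and \<open>w = u + 5\<close> to avoid
  truncated subtraction.\<close>

lemma matched_vertex:
  assumes "w < n"
  obtains x where "spiral_adj w x"
    "step_in w = of_bool (x = w + 1)" "\<And>u. w = u + 1 \<Longrightarrow> step_in u = of_bool (x = u)"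
    "jump_in w = of_bool (x = w + 5)" "\<And>u. w = u + 5 \<Longrightarrow> jump_in u = of_bool (x = u)"
    "\<And>u. {w, u} = {0, 3} \<Longrightarrow> chord_in = of_bool (x = u)"
proof -
  have "\<exists>!e. e \<in> M \<and> w \<in> e" using assms matching by (simp add: perfect_matching_def)
  then obtain e where e: "e \<in> M" "w \<in> e" by blast
  then have "e \<in> edge_set (spiral n)" using matching by (auto simp: perfect_matching_def)
  then obtain x where x: "e = {w, x}"
    using e(2) by (auto simp: edge_set_def)
  have out: "{w, y} \<in> M \<longleftrightarrow> x = y" for y
    using e(1) x matched_pair_unique[OF pair_graph_spiral matching] by blast
  have "{y, w} \<in> M \<longleftrightarrow> x = y" for y
    using out[of y] by (simp only: insert_commute[of y w])
  moreover have "spiral_adj w x" using e(1) x in_matchingD(3) by simp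
  moreover have "chord_in = of_bool (x = u)" if "{w, u} = {0, 3}" for u
    using out[of u] unfolding that by (simp add: chord_in_def)
  ultimately show thesis
    using out by (intro that) (simp_all add: step_in_def jump_in_def)
qed

text \<open>A vertex from 5 on has two spiral edges and two jumps, and never the chord. Edges
  leaving the graph count as 0.\<close>

lemma vertex_sum:
  assumes "v + 5 < n"
  shows "step_in (v + 4) + step_in (v + 5) + jump_in v + jump_in (v + 5) = 1"
proof (rule matched_vertex[OF assms])
  fix x
  assume x: "spiral_adj (v + 5) x"
    "step_in (v + 5) = of_bool (x = v + 5 + 1)" "\<And>u. v + 5 = u + 1 \<Longrightarrow> step_in u = of_bool (x = u)"
    "jump_in (v + 5) = of_bool (x = v + 5 + 5)" "\<And>u. v + 5 = u + 5 \<Longrightarrow> jump_in u = of_bool (x = u)"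
  have "step_in (v + 4) = of_bool (x = v + 4)" "jump_in v = of_bool (x = v)"
    by (rule x(3); simp) (rule x(5); simp)
  moreover have "x = v + 6 \<or> x = v + 4 \<or> x = v + 10 \<or> x = v"
    using x(1) by (auto simp: spiral_adj_def doubleton_eq_iff)
  ultimately show ?thesis
    using x(2,4) by (elim disjE) simp_all
qed

text \<open>The first five vertices have no jump inward; the chord meets 0 and 3.\<close>

lemma vertex_sum_center:
  assumes "10 \<le> n"
  shows "step_in 0 + jump_in 0 + chord_in = 1" "step_in 0 + step_in 1 + jump_in 1 = 1"
    "step_in 1 + step_in 2 + jump_in 2 = 1" "step_in 2 + step_in 3 + jump_in 3 + chord_in = 1"
    "step_in 3 + step_in 4 + jump_in 4 = 1"
proof -
  have lt: "0 < n" "1 < n" "2 < n" "3 < n" "4 < n" using assms by auto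
  show "step_in 0 + jump_in 0 + chord_in = 1"
  proof (rule matched_vertex[OF lt(1)])
    fix x
    assume x: "spiral_adj 0 x" "step_in 0 = of_bool (x = 0 + 1)" "jump_in 0 = of_bool (x = 0 + 5)"
      "\<And>u. {0, u} = {0, 3} \<Longrightarrow> chord_in = of_bool (x = u)"
    have "x = 1 \<or> x = 5 \<or> x = 3"
      using x(1) by (auto simp: spiral_adj_def doubleton_eq_iff)
    then show ?thesis using x(2,3) x(4)[of 3] by (elim disjE) simp_all
  qed
  show "step_in 0 + step_in 1 + jump_in 1 = 1"
  proof (rule matched_vertex[OF lt(2)])
    fix x
    assume x: "spiral_adj 1 x" "step_in 1 = of_bool (x = 1 + 1)" "jump_in 1 = of_bool (x = 1 + 5)"
      "\<And>u. 1 = u + 1 \<Longrightarrow> step_in u = of_bool (x = u)"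
    have "x = 0 \<or> x = 2 \<or> x = 6"
      using x(1) by (auto simp: spiral_adj_def doubleton_eq_iff)
    then show ?thesis using x(2,3) x(4)[of 0] by (elim disjE) simp_all
  qed
  show "step_in 1 + step_in 2 + jump_in 2 = 1"
  proof (rule matched_vertex[OF lt(3)])
    fix x
    assume x: "spiral_adj 2 x" "step_in 2 = of_bool (x = 2 + 1)" "jump_in 2 = of_bool (x = 2 + 5)"
      "\<And>u. 2 = u + 1 \<Longrightarrow> step_in u = of_bool (x = u)"
    have "x = 1 \<or> x = 3 \<or> x = 7"
      using x(1) by (auto simp: spiral_adj_def doubleton_eq_iff)
    then show ?thesis using x(2,3) x(4)[of 1] by (elim disjE) simp_all
  qed
  show "step_in 2 + step_in 3 + jump_in 3 + chord_in = 1"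
  proof (rule matched_vertex[OF lt(4)])
    fix x
    assume x: "spiral_adj 3 x" "step_in 3 = of_bool (x = 3 + 1)" "jump_in 3 = of_bool (x = 3 + 5)"
      "\<And>u. 3 = u + 1 \<Longrightarrow> step_in u = of_bool (x = u)" "\<And>u. {3, u} = {0, 3} \<Longrightarrow> chord_in = of_bool (x = u)"
    have "x = 2 \<or> x = 4 \<or> x = 8 \<or> x = 0"
      using x(1) by (auto simp: spiral_adj_def doubleton_eq_iff)
    then show ?thesis using x(2,3) x(4)[of 2] x(5)[of 0, OF insert_commute] by (elim disjE) simp_all
  qed
  show "step_in 3 + step_in 4 + jump_in 4 = 1"
  proof (rule matched_vertex[OF lt(5)])
    fix x
    assume x: "spiral_adj 4 x" "step_in 4 = of_bool (x = 4 + 1)" "jump_in 4 = of_bool (x = 4 + 5)"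
      "\<And>u. 4 = u + 1 \<Longrightarrow> step_in u = of_bool (x = u)"
    have "x = 3 \<or> x = 5 \<or> x = 9"
      using x(1) by (auto simp: spiral_adj_def doubleton_eq_iff)
    then show ?thesis using x(2,3) x(4)[of 3] by (elim disjE) simp_all
  qed
qed

lemma step_in_beyond: "n \<le> v + 1 \<Longrightarrow> step_in v = 0"
  using in_matchingD(2)[of v "v + 1"] by (auto simp: step_in_def)

lemma jump_in_beyond: "n \<le> v + 5 \<Longrightarrow> jump_in v = 0"
  using in_matchingD(2)[of v "v + 5"] by (auto simp: jump_in_def)

text \<open>
  The height of v is the height, relative to the base matching, of the face on the inner side of
  {v, v + 1}; the face on the outer side of this edge is the inner face of {v + 5, v + 6}.  The
  innermost two faces are each met by several values of v.  Faces that share an edge {u, u + 5}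
  are compared in \<open>height_lateral\<close>.
\<close>

definition slope :: "nat \<Rightarrow> int" where
  "slope v = (if even v then 1 - step_in v else step_in v)"

lemma slope_range: "slope v = 0 \<or> slope v = 1"
  by (auto simp: slope_def step_in_def)

function height :: "nat \<Rightarrow> int" where
  "height v = (if v < n then height (v + 5) + slope v else 0)"
  by auto
termination by (relation "measure (\<lambda>v. n - v)") auto

declare height.simps [simp del]

lemma height_step: "v < n \<Longrightarrow> height v = height (v + 5) + slope v"
  by (subst height.simps) simp

text \<open>Indices from \<open>n\<close> on stand for the unbounded face, which is the zero
  level.\<close>

lemma height_beyond: "n \<le> v \<Longrightarrow> height v = 0"
  by (subst height.simps) simp

lemma height_nonneg: "0 \<le> height v"
proof (induction v rule: height.induct)
  case (1 v)
  then show ?case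
    using slope_range[of v] height_step[of v] height_beyond[of v] by (cases "v < n") auto
qed

text \<open>Heights are defined by crossing spiral edges only; this is their consistency when
  crossing the jump \<open>{u, u + 5}\<close>. The induction runs inward from the unbounded face:
  going around the vertex \<open>u + 5\<close>, the changes of height cancel by
  \<open>vertex_sum\<close>.\<close>

lemma height_lateral:
  "height (u + 4) = height (u + 5) + (if even u then jump_in u else - jump_in u)"
proof (induction "n - u" arbitrary: u rule: less_induct)
  case less
  show ?case
  proof (cases "u + 5 < n")
    case True
    have "height (u + 5 + 4) = height (u + 5 + 5)
      + (if even (u + 5) then jump_in (u + 5) else - jump_in (u + 5))"
      using True by (intro less.hyps) simp
    moreover have "height (u + 4) = height (u + 5 + 4) + slope (u + 4)"
      using True height_step[of "u + 4"] by (simp add: add.assoc)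
    moreover have "height (u + 5) = height (u + 5 + 5) + slope (u + 5)"
      using True by (rule height_step)
    ultimately show ?thesis
      using vertex_sum[OF True] by (auto simp: slope_def)
  next
    case False
    then have "height (u + 5) = 0" "jump_in u = 0"
      by (simp_all add: height_beyond jump_in_beyond)
    moreover have "height (u + 4) = 0"
    proof (cases "u + 4 < n")
      case True
      then have "n = u + 5" using False by simp
      \<comment> \<open>Here \<open>u + 4 = n - 1\<close> is odd because \<open>n\<close> is even,
        so the slope is the indicator of a spiral edge leaving the last vertex, which is 0.\<close>
      then have "slope (u + 4) = 0"
        using even_n step_in_beyond[of "u + 4"] by (simp add: slope_def)
      then show ?thesis
        using True \<open>n = u + 5\<close> height_step[of "u + 4"] height_beyond[of "u + 4 + 5"] by simp
    qed (simp add: height_beyond)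
    ultimately show ?thesis by simp
  qed
qed

text \<open>Indices 0, 1, 2 denote the face 0, 1, 2, 3, and indices 3, 4 the face 0, 3, 4, 5; only
  the chord separates the two. The equations come from going around the vertices 1, 2, 3 and
  4.\<close>

lemma height_lateral_center:
  assumes "10 \<le> n"
  shows "height 0 = height 1" "height 1 = height 2" "height 2 = height 3 + chord_in" "height 3 = height 4"
proof -
  have "height v = height (v + 5) + slope v" if "v < 5" for v
    using that assms height_step[of v] by simp
  from this[of 0] this[of 1] this[of 2] this[of 3] this[of 4]
  have h: "height 0 = height 5 + (1 - step_in 0)" "height 1 = height 6 + step_in 1"
    "height 2 = height 7 + (1 - step_in 2)" "height 3 = height 8 + step_in 3"
    "height 4 = height 9 + (1 - step_in 4)"
    by (simp_all add: slope_def)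
  have l: "height 5 = height 6 - jump_in 1" "height 6 = height 7 + jump_in 2"
    "height 7 = height 8 - jump_in 3" "height 8 = height 9 + jump_in 4"
    using height_lateral[of 1] height_lateral[of 2] height_lateral[of 3] height_lateral[of 4] by simp_all
  note s = vertex_sum_center[OF assms]
  show "height 0 = height 1" using h l s(2) by linarith
  show "height 1 = height 2" using h l s(3) by linarith
  show "height 2 = height 3 + chord_in" using h l s(4) by linarith
  show "height 3 = height 4" using h l s(5) by linarith
qed

section \<open>Descent to the base matching\<close>

text \<open>Without height there is no slope, so \<open>M\<close> contains every base edge. These
  already cover all vertices and leave no room for another edge.\<close>

lemma base_matching_if_height_zero:
  assumes "\<And>v. v < n \<Longrightarrow> height v = 0"
  shows "M = base_matching n"
proof -
  have base: "{v, v + 1} \<in> M" if "even v" "v < n" for v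
  proof -
    have "slope v = 0"
      using assms[OF that(2)] height_step[OF that(2)] height_nonneg[of "v + 5"] slope_range[of v]
      by linarith
    then show ?thesis using that by (auto simp: slope_def step_in_def)
  qed
  then have "base_matching n \<subseteq> M" by (auto simp: base_matching_def)
  moreover have "e \<in> base_matching n" if "e \<in> M" for e
  proof -
    have "e \<in> edge_set (spiral n)" using that matching by (auto simp: perfect_matching_def)
    then obtain x where x: "x \<in> e" "x < n" by (auto simp: edge_set_def spiral_def)
    define v where "v = 2 * (x div 2)"
    have "even v" "x \<in> {v, v + 1}" "v < n" using x by (auto simp: v_def)
    then have "e = {v, v + 1}"
      using perfect_matching_unique[OF pair_graph_spiral matching that base] x by blast
    then show ?thesis using \<open>even v\<close> \<open>v < n\<close> by (auto simp: base_matching_def)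
  qed
  ultimately show ?thesis by blast
qed

lemma exchange_descent:
  assumes "{a, b} \<in> M" "{c, d} \<in> M" "{a, b} \<noteq> {c, d}" "spiral_adj c b" "spiral_adj a d"
    and "edge_wt c b + edge_wt a d < edge_wt a b + edge_wt c d"
  shows "\<exists>M'. perfect_matching (spiral n) M' \<and> switch (spiral n) M M' \<and> potential n M' < potential n M"
proof -
  have "{c, b} \<in> edge_set (spiral n)" "{a, d} \<in> edge_set (spiral n)"
    using assms in_matchingD by (simp_all add: edge_set_spiral)
  note e = assms(1-3) this
  show ?thesis
    using perfect_matching_exchange[OF pair_graph_spiral matching e] potential_exchange[OF matching e] assms(6)
    by (intro exI[of _ "M - {{a, b}, {c, d}} \<union> {{c, b}, {a, d}}"]) simp
qed

text \<open>A maximal face cannot be left upwards, and the last one is left strictly downwards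
  towards all larger indices. This forces two opposite edges of a quadrilateral into
  \<open>M\<close>, and flipping them lowers the total height.\<close>

lemma descent:
  assumes "10 \<le> n" "M \<noteq> base_matching n"
  shows "\<exists>M'. perfect_matching (spiral n) M' \<and> switch (spiral n) M M' \<and> potential n M' < potential n M"
proof -
  define H where "H = Max (height ` {..<n})"
  have fin: "finite (height ` {..<n})" by simp
  have le_H: "height u \<le> H" if "u < n" for u using that by (simp add: H_def)
  obtain u where u: "u < n" "height u \<noteq> 0" using assms(2) base_matching_if_height_zero by blast
  have "0 < H" using le_H[OF u(1)] height_nonneg[of u] u(2) by linarith
  have "H \<in> height ` {..<n}" unfolding H_def using u(1) by (intro Max_in) auto
  then have ne: "{v. v < n \<and> height v = H} \<noteq> {}" by auto
  \<comment> \<open>The largest index is the outermost position of the maximum, which forces the edges around it.\<close>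
  define v where "v = Max {v. v < n \<and> height v = H}"
  have v: "v < n" "height v = H" using Max_in[OF _ ne] by (auto simp: v_def)
  have less_H: "height w < H" if "v < w" for w
  proof (cases "w < n")
    case True
    have "height w \<noteq> H"
    proof
      assume "height w = H"
      then have "w \<le> v" unfolding v_def using True by (intro Max_ge) auto
      then show False using that by simp
    qed
    then show ?thesis using le_H[OF True] by simp
  next
    case False
    then show ?thesis using \<open>0 < H\<close> by (simp add: height_beyond)
  qed
  have le_H': "height w \<le> H" for w
    using le_H[of w] less_H[of w] v by (cases "w < n") auto
  \<comment> \<open>The face across \<open>{w, w + 1}\<close> has index \<open>w + 5 > v\<close> and
    is therefore lower.\<close>
  have slope_top: "slope w = 1" if "height w = H" "v \<le> w + 4" "w < n" for w
    using that height_step[of w] less_H[of "w + 5"] slope_range[of w] by auto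
  have slope_below: "slope w = 0" if "height (w + 5) = H" for w
    using that height_step[of w] le_H'[of w] slope_range[of w] height_beyond[of "w + 5"] \<open>0 < H\<close>
    by (cases "w < n") auto
  \<comment> \<open>The height drops from \<open>v\<close> to \<open>v + 1\<close>, and by
    \<open>height_lateral\<close> only a jump from an even vertex does this. Near the centre, 1 and
    3 denote the same faces as 2 and 4, so neither is the last index.\<close>
  have "even v"
  proof (cases "v < 4")
    case True
    then have "v \<noteq> 1" "v \<noteq> 3"
      using height_lateral_center[OF assms(1)] less_H[of 2] less_H[of 4] v by auto
    moreover have "v = 0 \<or> v = 1 \<or> v = 2 \<or> v = 3" using True by auto
    ultimately show ?thesis by auto
  next
    case False
    then have "v = (v - 4) + 4" by simp
    then obtain w where w: "v = w + 4" by blast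
    show ?thesis
      using height_lateral[of w] less_H[of "w + 5"] v w
      by (auto simp: jump_in_def of_bool_def split: if_splits)
  qed
  have "v \<noteq> 0"
  proof
    assume "v = 0"
    then show False using height_lateral_center(1)[OF assms(1)] less_H[of 1] v by simp
  qed
  then have "v = 2 \<or> v = 4 \<or> 6 \<le> v" using \<open>even v\<close> by presburger
  then consider "v = 2" | "v = 4" | "6 \<le> v" by blast
  then show ?thesis
  proof cases
    \<comment> \<open>The face 0, 1, 2, 3 is maximal: the lower face 0, 3, 4, 5 forces the chord,
      and the lower face outside \<open>{1, 2}\<close> forces that edge.\<close>
    case 1
    have "{0, 3} \<in> M"
      using height_lateral_center(3)[OF assms(1)] less_H[of 3] v 1
      by (auto simp: chord_in_def of_bool_def split: if_splits)
    moreover have "{1, 2} \<in> M"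
      using slope_top[of 1] height_lateral_center(2)[OF assms(1)] v 1
      by (auto simp: slope_def step_in_def of_bool_def eval_nat_numeral split: if_splits)
    ultimately show ?thesis
      by (intro exchange_descent[of 2 1 0 3])
        (auto simp: spiral_adj_def doubleton_eq_iff edge_wt_def wt_def insert_commute)
  next
    \<comment> \<open>The face 0, 3, 4, 5 is maximal; the lower faces across \<open>{0, 5}\<close>
      and \<open>{3, 4}\<close> force these edges.\<close>
    case 2
    have "{0, 5} \<in> M"
      using height_lateral[of 0] less_H[of 5] v 2
      by (auto simp: jump_in_def of_bool_def split: if_splits)
    moreover have "{3, 4} \<in> M"
      using slope_top[of 3] height_lateral_center(4)[OF assms(1)] v 2
      by (auto simp: slope_def step_in_def of_bool_def split: if_splits)
    ultimately show ?thesis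
      by (intro exchange_descent[of 4 3 0 5])
        (auto simp: spiral_adj_def doubleton_eq_iff edge_wt_def wt_def insert_commute)
  next
    case 3
    then have "v = (v - 6) + 6" by simp
    then obtain w where w: "v = w + 6" by blast
    have "even w" using \<open>even v\<close> w by simp
    have next_lower: "{w + 2, w + 7} \<in> M"
      using height_lateral[of "w + 2"] less_H[of "v + 1"] v w \<open>even w\<close>
      by (auto simp: jump_in_def of_bool_def add.commute split: if_splits)
    have lateral: "height (w + 5) = H - jump_in (w + 1)"
      using height_lateral[of "w + 1"] v w \<open>even w\<close> by (simp add: add.commute)
    show ?thesis
    proof (cases "{w + 1, w + 6} \<in> M")
      \<comment> \<open>Both jumps bounding the face of \<open>v\<close> are matched, so this face
        is flipped. The outer spiral edge gained is negative and outweighs the inner one.\<close>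
      case True
      have "edge_wt (w + 1) (w + 2) + edge_wt (w + 7) (w + 6) < 0"
        using \<open>even w\<close> by (simp add: edge_wt_def wt_def)
      then show ?thesis
        using True next_lower
        by (intro exchange_descent[of "w + 7" "w + 2" "w + 1" "w + 6"])
          (auto simp: spiral_adj_def doubleton_eq_iff edge_wt_def insert_commute)
    next
      \<comment> \<open>The preceding face, of index \<open>w + 5\<close>, is then maximal too. Its
        outer side leads down and its inner side cannot lead up, so both its spiral edges are
        matched and are exchanged for jumps of weight 0.\<close>
      case False
      then have "height (w + 5) = H" using lateral by (simp add: jump_in_def add.commute)
      then have "slope (w + 5) = 1" "slope w = 0"
        using slope_top[of "w + 5"] slope_below[of w] v w by auto
      then have "{w + 5, w + 6} \<in> M" "{w, w + 1} \<in> M"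
        using \<open>even w\<close> by (auto simp: slope_def step_in_def of_bool_def add.commute split: if_splits)
      moreover have "edge_wt (w + 6) (w + 5) + edge_wt (w + 1) w > 0"
        using \<open>even w\<close> by (simp add: edge_wt_def wt_def)
      ultimately show ?thesis
        by (intro exchange_descent[of "w + 6" "w + 5" w "w + 1"])
          (auto simp: spiral_adj_def doubleton_eq_iff edge_wt_def insert_commute)
    qed
  qed
qed

end

section \<open>Two matchings whose potentials differ quadratically\<close>

text \<open>For an involution \<open>m\<close>, membership of an edge becomes an equation between
  vertices, which makes the potential computable.\<close>

definition matching_of :: "nat \<Rightarrow> (nat \<Rightarrow> nat) \<Rightarrow> nat set set" where
  "matching_of n m = {{w, m w} |w. w < n}"

lemma in_matching_of:
  assumes "\<And>w. w < n \<Longrightarrow> m (m w) = w" and "x < n"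
  shows "{x, y} \<in> matching_of n m \<longleftrightarrow> y = m x"
  using assms by (auto simp: matching_of_def doubleton_eq_iff)

lemma perfect_matching_of:
  assumes adj: "\<And>w. w < n \<Longrightarrow> m w < n \<and> spiral_adj w (m w)" and inv: "\<And>w. w < n \<Longrightarrow> m (m w) = w"
  shows "perfect_matching (spiral n) (matching_of n m)"
  unfolding perfect_matching_def
proof (intro conjI ballI)
  show "matching_of n m \<subseteq> edge_set (spiral n)"
    using adj by (auto simp: matching_of_def edge_set_spiral)
  fix w assume "w \<in> pverts (spiral n)"
  then have w: "w < n" by simp
  show "\<exists>!e. e \<in> matching_of n m \<and> w \<in> e"
  proof (rule ex1I[of _ "{w, m w}"])
    show "{w, m w} \<in> matching_of n m \<and> w \<in> {w, m w}"
      using in_matching_of[of n m, OF inv w] by simp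
    fix e assume e: "e \<in> matching_of n m \<and> w \<in> e"
    then obtain u where "u < n" "e = {u, m u}" by (auto simp: matching_of_def)
    then show "e = {w, m w}" using e inv by auto
  qed
qed

definition base_mate :: "nat \<Rightarrow> nat" where
  "base_mate w = (if even w then w + 1 else w - 1)"

text \<open>
  A nearly highest matching: in every block of ten vertices the jump 10j + 4 ~ 10j + 9 shifts the
  parity of the spiral edges.
\<close>

definition far_mate :: "nat \<Rightarrow> nat" where
  "far_mate w = (if w mod 10 \<in> {0, 2, 5, 7} then w + 1 else if w mod 10 = 4 then w + 5
    else if w mod 10 = 9 then w - 5 else w - 1)"

lemma base_mate_involution: "base_mate (base_mate w) = w"
  by (auto simp: base_mate_def elim: oddE)

lemma base_matching_eq: "base_matching n = matching_of n base_mate"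
proof
  show "base_matching n \<subseteq> matching_of n base_mate"
    unfolding base_matching_def matching_of_def base_mate_def by force
  show "matching_of n base_mate \<subseteq> base_matching n"
  proof
    fix e assume "e \<in> matching_of n base_mate"
    then obtain w where w: "w < n" "e = {w, base_mate w}" by (auto simp: matching_of_def)
    show "e \<in> base_matching n"
    proof (cases "even w")
      case True
      then show ?thesis using w by (auto simp: base_matching_def base_mate_def)
    next
      case False
      then obtain k where "w = 2 * k + 1" by (rule oddE)
      then show ?thesis
        using w unfolding base_matching_def base_mate_def
        by (intro CollectI exI[of _ "2 * k"]) auto
    qed
  qed
qed

lemma perfect_matching_base:
  assumes "even n"
  shows "perfect_matching (spiral n) (base_matching n)"
  unfolding base_matching_eq
proof (rule perfect_matching_of)
  fix w assume "w < n"
  have "w + 1 < n" if "even w" using that assms \<open>w < n\<close> by presburger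
  then show "base_mate w < n \<and> spiral_adj w (base_mate w)"
    using \<open>w < n\<close> by (auto simp: base_mate_def spiral_adj_def elim: oddE)
qed (rule base_mate_involution)

lemma far_mate_block:
  "far_mate (10 * j) = 10 * j + 1" "far_mate (10 * j + 1) = 10 * j" "far_mate (10 * j + 2) = 10 * j + 3"
  "far_mate (10 * j + 3) = 10 * j + 2" "far_mate (10 * j + 4) = 10 * j + 9"
  "far_mate (10 * j + 5) = 10 * j + 6" "far_mate (10 * j + 6) = 10 * j + 5"
  "far_mate (10 * j + 7) = 10 * j + 8" "far_mate (10 * j + 8) = 10 * j + 7" "far_mate (10 * j + 9) = 10 * j + 4"
  unfolding far_mate_def mod_mult_self4 by simp_all

lemma block_cases:
  fixes w :: nat
  obtains j where "w \<in> {10 * j, 10 * j + 1, 10 * j + 2, 10 * j + 3, 10 * j + 4,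
    10 * j + 5, 10 * j + 6, 10 * j + 7, 10 * j + 8, 10 * j + 9}"
proof -
  define j where "j = w div 10"
  define r where "r = w mod 10"
  have "w = 10 * j + r" by (simp add: j_def r_def)
  moreover have "r = 0 \<or> r = 1 \<or> r = 2 \<or> r = 3 \<or> r = 4 \<or> r = 5 \<or> r = 6 \<or> r = 7 \<or> r = 8 \<or> r = 9"
    unfolding r_def by presburger
  ultimately show thesis using that[of j] by auto
qed

lemma far_mate_involution: "far_mate (far_mate w) = w"
  by (rule block_cases[of w]) (auto simp only: insert_iff empty_iff far_mate_block)

lemma perfect_matching_far: "perfect_matching (spiral (10 * K)) (matching_of (10 * K) far_mate)"
proof (rule perfect_matching_of)
  fix w assume w: "w < 10 * K"
  obtain j where j: "w \<in> {10 * j, 10 * j + 1, 10 * j + 2, 10 * j + 3, 10 * j + 4,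
    10 * j + 5, 10 * j + 6, 10 * j + 7, 10 * j + 8, 10 * j + 9}" by (rule block_cases)
  have "10 * j \<le> w" using j by auto
  then have "10 * j + 9 < 10 * K" using w by presburger
  with j show "far_mate w < 10 * K \<and> spiral_adj w (far_mate w)"
    unfolding insert_iff empty_iff
    by (elim disjE) (simp_all add: far_mate_block far_mate_block[simplified] spiral_adj_def)
qed (rule far_mate_involution)

text \<open>The block with index \<open>k\<close> contributes \<open>10 * k + 9\<close>. Within it
  the matchings differ on the spiral edges starting at offsets 4 to 8: the base matching has those
  from even vertices, of negative weight, and the far one those from odd vertices, of positive
  weight.\<close>

lemma far_minus_base_sum:
  "(\<Sum>v<10 * K. (of_bool (v + 1 = far_mate v) - of_bool (v + 1 = base_mate v)) * wt v)
    = 5 * (int K)\<^sup>2 + 4 * int K"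
proof (induction K)
  case 0
  then show ?case by simp
next
  case (Suc K)
  define g where "g v = (of_bool (v + 1 = far_mate v) - of_bool (v + 1 = base_mate v)) * wt v" for v
  have split: "sum g {..<10 * Suc K} = sum g {..<10 * K} + (g (10 * K) + g (10 * K + 1) + g (10 * K + 2)
    + g (10 * K + 3) + g (10 * K + 4) + g (10 * K + 5) + g (10 * K + 6) + g (10 * K + 7)
    + g (10 * K + 8) + g (10 * K + 9))"
    by (simp add: numeral_eq_Suc)
  have unchanged: "g (10 * K) = 0" "g (10 * K + 1) = 0" "g (10 * K + 2) = 0" "g (10 * K + 3) = 0"
    "g (10 * K + 9) = 0"
    unfolding g_def far_mate_block by (simp_all add: base_mate_def)
  have changed: "g (10 * K + 4) = 2 * int K + 1" "g (10 * K + 5) = 2 * int K + 2"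
    "g (10 * K + 6) = 2 * int K + 2" "g (10 * K + 7) = 2 * int K + 2" "g (10 * K + 8) = 2 * int K + 2"
    unfolding g_def far_mate_block by (simp_all add: base_mate_def wt_def)
  have "sum g {..<10 * K} = 5 * (int K)\<^sup>2 + 4 * int K"
    using Suc.IH unfolding g_def[abs_def] .
  then have "sum g {..<10 * Suc K} = 5 * (int (Suc K))\<^sup>2 + 4 * int (Suc K)"
    unfolding split unchanged changed by (simp add: power2_eq_square algebra_simps)
  then show ?case unfolding g_def[abs_def] .
qed

lemma potential_far:
  "potential (10 * K) (matching_of (10 * K) far_mate) - potential (10 * K) (base_matching (10 * K))
    = 5 * (int K)\<^sup>2 + 4 * int K"
  unfolding potential_def base_matching_eq far_minus_base_sum[symmetric] sum_subtractf[symmetric]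
  by (rule sum.cong)
    (simp_all add: in_matching_of far_mate_involution base_mate_involution left_diff_distrib)

section \<open>Connectivity and diameter of the transition graph\<close>

lemma connected_transition_graph_spiral:
  assumes "even n" "10 \<le> n"
  shows "Digraph_Component.connected (with_proj (transition_graph (spiral n)))"
proof (rule connected_if_descent[where f = "potential n"])
  show "pair_graph (transition_graph (spiral n))"
    by (rule pair_graph_transition_graph[OF pair_graph_spiral])
  show "base_matching n \<in> pverts (transition_graph (spiral n))"
    using perfect_matching_base[OF assms(1)] by (simp add: transition_graph_def)
  fix M assume "M \<in> pverts (transition_graph (spiral n))" and ne: "M \<noteq> base_matching n"
  then have M: "perfect_matching (spiral n) M" by (simp add: transition_graph_def)
  interpret spiral_matching n M using assms(1) M by unfold_locales
  obtain M' where "perfect_matching (spiral n) M'" "switch (spiral n) M M'" "potential n M' < potential n M"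
    using descent[OF assms(2) ne] by blast
  then show "\<exists>M'. (M, M') \<in> parcs (transition_graph (spiral n)) \<and> potential n M' < potential n M"
    using M by (intro exI[of _ M']) (auto simp: transition_graph_def)
qed

text \<open>With \<open>n = 10 * K\<close> the potentials differ by at least
  \<open>5 * K^2 = n^2 / 20\<close>, and a switch changes the potential by at most 3; hence the
  constant \<open>1 / 60\<close>.\<close>

lemma graph_diameter_spiral:
  "ereal (1 / 60 * (real (10 * K))\<^sup>2) \<le> graph_diameter (transition_graph (spiral (10 * K)))"
proof (rule graph_diameter_ge[where L = 3 and f = "\<lambda>M. real_of_int (potential (10 * K) M)"])
  show "pair_graph (transition_graph (spiral (10 * K)))"
    by (rule pair_graph_transition_graph[OF pair_graph_spiral])
  show "base_matching (10 * K) \<in> pverts (transition_graph (spiral (10 * K)))"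
    "matching_of (10 * K) far_mate \<in> pverts (transition_graph (spiral (10 * K)))"
    using perfect_matching_base[of "10 * K"] perfect_matching_far by (simp_all add: transition_graph_def)
  have "real_of_int (potential (10 * K) (matching_of (10 * K) far_mate))
      - real_of_int (potential (10 * K) (base_matching (10 * K))) = 5 * (real K)\<^sup>2 + 4 * real K"
    using arg_cong[OF potential_far[of K], of real_of_int] by simp
  then show "3 * (1 / 60 * (real (10 * K))\<^sup>2) \<le> real_of_int (potential (10 * K) (matching_of (10 * K) far_mate))
      - real_of_int (potential (10 * K) (base_matching (10 * K)))"
    by (simp add: power2_eq_square)
  fix M M' assume "(M, M') \<in> parcs (transition_graph (spiral (10 * K)))"
  then have "\<bar>potential (10 * K) M' - potential (10 * K) M\<bar> \<le> 3"
    by (intro potential_switch) (auto simp: transition_graph_def)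
  then show "\<bar>real_of_int (potential (10 * K) M') - real_of_int (potential (10 * K) M)\<bar> \<le> 3"
    by linarith
qed simp

theorem theorem16:
  shows "\<exists>(N :: nat set) (G :: nat \<Rightarrow> nat pair_pre_digraph).
    infinite N \<and>
    (\<forall>n \<in> N. n > 0 \<and> pair_graph (G n) \<and> card (pverts (G n)) = n \<and>
       Digraph_Component.connected (with_proj (transition_graph (G n)))) \<and>
    (\<exists>c :: real. c > 0 \<and>
       (\<exists>n0. \<forall>n \<in> N. n \<ge> n0 \<longrightarrow>
          ereal (c * (real n)\<^sup>2) \<le> graph_diameter (transition_graph (G n))))"
proof (intro exI conjI)
  \<comment> \<open>Positive multiples of 10 are even, reach the size that the centre requires, and
    split into the blocks of the far matching.\<close>
  define N :: "nat set" where "N = range (\<lambda>k. 10 * Suc k)"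
  have "inj (\<lambda>k. 10 * Suc k)" by (auto intro: injI)
  then show "infinite N" unfolding N_def by (simp add: finite_image_iff)
  show "\<forall>n \<in> N. n > 0 \<and> pair_graph (spiral n) \<and> card (pverts (spiral n)) = n \<and>
      Digraph_Component.connected (with_proj (transition_graph (spiral n)))"
  proof
    fix n assume "n \<in> N"
    then have "10 \<le> n" "even n" by (auto simp: N_def)
    then show "n > 0 \<and> pair_graph (spiral n) \<and> card (pverts (spiral n)) = n \<and>
        Digraph_Component.connected (with_proj (transition_graph (spiral n)))"
      using connected_transition_graph_spiral pair_graph_spiral by simp
  qed
  show "(1 / 60 :: real) > 0" by simp
  show "\<forall>n \<in> N. n \<ge> 0 \<longrightarrow> ereal (1 / 60 * (real n)\<^sup>2) \<le> graph_diameter (transition_graph (spiral n))"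
    unfolding N_def using graph_diameter_spiral by blast
qed

end
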